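(* Let $f:\mathbb{R}^{N\times n}\to\mathbb{R}$ be Borel measurable. (a) If $f$ is strong Morrey quasiconvex, then $f$ is weak Morrey quasiconvex and periodic-weak Morrey quasiconvex. (b) If $f$ is periodic-weak Morrey quasiconvex, then $f$ is weak Morrey quasiconvex. (c) If $f$ is weak Morrey quasiconvex and upper semicontinuous, then $f$ is rank-one quasiconvex. (d) If $f$ is periodic-weak Morrey quasiconvex in every cube $C\subseteq\mathbb{R}^n$, then $f$ is rank-one quasiconvex. In particular, every strong Morrey quasiconvex $f$ is rank-one quasiconvex.
   Context: $Q:=(-\tfrac12,\tfrac12)^n$; $W^{1,\infty}_0(Q;\mathbb{R}^N):=W^{1,\infty}\cap W^{1,1}_0$; for a cube $C$, $W^{1,\infty}_{\rm per}(C;\mathbb{R}^N)$ = $C$-periodic functions in $W^{1,\infty}(\mathbb{R}^n;\mathbb{R}^N)$. Weak Morrey quasiconvex: $f(\xi)\le\operatorname{ess\,sup}_{x\in Q}f(\xi+D\varphi(x))$ for all $\xi$ and $\varphi\in W^{1,\infty}_0(Q;\mathbb{R}^N)$. Periodic-weak Morrey quasiconvex in a cube $C$: $f(\xi)\le\operatorname{ess\,sup}_{x\in C}f(\xi+D\varphi(x))$ for all $\xi$ and $\varphi\in W^{1,\infty}_{\rm per}(C;\mathbb{R}^N)$ (without specification, $C=Q$). Strong Morrey quasiconvex: for every $\varepsilon>0,\xi,K>0$ there is $\delta>0$ such that $\varphi\in W^{1,\infty}(Q;\mathbb{R}^N)$, $\|D\varphi\|_{L^\infty(Q)}\le K$,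 $\max_{\partial Q}|\varphi|\le\delta$ imply $f(\xi)\le\operatorname{ess\,sup}_{Q}f(\xi+D\varphi)+\varepsilon$. Rank-one quasiconvex: $f(\lambda\xi+(1-\lambda)\eta)\le\max\{f(\xi),f(\eta)\}$ whenever $\operatorname{rank}(\xi-\eta)=1$, $\lambda\in(0,1)$. *)

theory Defs
  imports "HOL-Analysis.Analysis"
begin

text \<open>Matrices in R^(N x n) are rendered as real^'n^'N (N rows, n columns);
  maps R^n -> R^N as real^'n \<Rightarrow> real^'N.\<close>

definition ess_sup :: "'a measure \<Rightarrow> ('a \<Rightarrow> ereal) \<Rightarrow> ereal" where
  "ess_sup M g = Inf {z. AE x in M. g x \<le> z}"

definition grad :: "(real^'n \<Rightarrow> real^'N) \<Rightarrow> real^'n \<Rightarrow> real^'n^'N" where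
  "grad \<phi> x = matrix (frechet_derivative \<phi> (at x))"

text \<open>ess sup over a set S of x \<mapsto> f(\<xi> + D\<phi>(x)); D\<phi> exists a.e. (Rademacher);
  at the null set of non-differentiability points the integrand is set to -\<infinity>.\<close>
definition ess_sup_grad ::
  "(real^'n^'N \<Rightarrow> real) \<Rightarrow> real^'n^'N \<Rightarrow> (real^'n \<Rightarrow> real^'N) \<Rightarrow> (real^'n) set \<Rightarrow> ereal" where
  "ess_sup_grad f \<xi> \<phi> S = ess_sup (lebesgue_on S)
     (\<lambda>x. if \<phi> differentiable (at x) then ereal (f (\<xi> + grad \<phi> x)) else - \<infinity>)"

definition unit_cube :: "(real^'n) set" where
  "unit_cube = box (\<chi> i. - 1/2) (\<chi> i. 1/2)"

text \<open>W^{1,\<infinity>}_0(Q;R^N) = W^{1,\<infinity>} \<inter> W^{1,1}_0: Lipschitz maps vanishing on the boundary,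
  represented as Lipschitz maps R^n -> R^N vanishing outside Q.\<close>
definition W1inf0_Q :: "(real^'n \<Rightarrow> real^'N) set" where
  "W1inf0_Q = {\<phi>. (\<exists>L. L-lipschitz_on UNIV \<phi>) \<and> (\<forall>x. x \<notin> unit_cube \<longrightarrow> \<phi> x = 0)}"

definition cube :: "real^'n \<Rightarrow> real \<Rightarrow> real^'n^'n \<Rightarrow> (real^'n) set" where
  "cube c r R = (\<lambda>y. c + R *v y) ` box (\<chi> i. - r/2) (\<chi> i. r/2)"

text \<open>W^{1,\<infinity>}_per(C;R^N) for C = cube c r R: bounded Lipschitz maps on R^n, periodic
  with respect to the edge vectors r * (column i of R) of the cube.\<close>
definition W1inf_per :: "real^'n \<Rightarrow> real \<Rightarrow> real^'n^'n \<Rightarrow> (real^'n \<Rightarrow> real^'N) set" where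
  "W1inf_per c r R = {\<phi>. (\<exists>L. L-lipschitz_on UNIV \<phi>) \<and> bounded (range \<phi>) \<and>
      (\<forall>x i. \<phi> (x + r *\<^sub>R column i R) = \<phi> x)}"

definition weak_MQC :: "(real^'n^'N \<Rightarrow> real) \<Rightarrow> bool" where
  "weak_MQC f \<longleftrightarrow> (\<forall>\<xi> \<phi>. \<phi> \<in> W1inf0_Q \<longrightarrow> ereal (f \<xi>) \<le> ess_sup_grad f \<xi> \<phi> unit_cube)"

definition periodic_weak_MQC_in ::
  "real^'n \<Rightarrow> real \<Rightarrow> real^'n^'n \<Rightarrow> (real^'n^'N \<Rightarrow> real) \<Rightarrow> bool" where
  "periodic_weak_MQC_in c r R f \<longleftrightarrow>
     (\<forall>\<xi> \<phi>. \<phi> \<in> W1inf_per c r R \<longrightarrow> ereal (f \<xi>) \<le> ess_sup_grad f \<xi> \<phi> (cube c r R))"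

definition periodic_weak_MQC :: "(real^'n^'N \<Rightarrow> real) \<Rightarrow> bool" where
  "periodic_weak_MQC f \<longleftrightarrow> periodic_weak_MQC_in 0 1 (mat 1) f"

text \<open>Strong Morrey quasiconvexity. \<phi> \<in> W^{1,\<infinity>}(Q;R^N) is represented by a map
  on R^n that is Lipschitz on the closed cube (its values outside are irrelevant,
  boundary values are those of the continuous extension). ||D\<phi>||_{L^\<infinity>(Q)} \<le> K
  is stated with the (Frobenius) norm on real^'n^'N.\<close>
definition strong_MQC :: "(real^'n^'N \<Rightarrow> real) \<Rightarrow> bool" where
  "strong_MQC f \<longleftrightarrow> (\<forall>\<epsilon>>0. \<forall>\<xi>. \<forall>K>0. \<exists>\<delta>>0. \<forall>\<phi>.
     (\<exists>L. L-lipschitz_on (closure unit_cube) \<phi>) \<and>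
     (AE x in lebesgue_on unit_cube. \<phi> differentiable (at x) \<longrightarrow> norm (grad \<phi> x) \<le> K) \<and>
     (\<forall>x\<in>frontier unit_cube. norm (\<phi> x) \<le> \<delta>)
     \<longrightarrow> ereal (f \<xi>) \<le> ess_sup_grad f \<xi> \<phi> unit_cube + ereal \<epsilon>)"

definition rank_one_convex :: "(real^'n^'N \<Rightarrow> real) \<Rightarrow> bool" where
  "rank_one_convex f \<longleftrightarrow> (\<forall>\<xi> \<eta> t. rank (\<xi> - \<eta>) = 1 \<and> 0 < t \<and> t < 1 \<longrightarrow>
     f (t *\<^sub>R \<xi> + (1 - t) *\<^sub>R \<eta>) \<le> max (f \<xi>) (f \<eta>))"

definition upper_semicont :: "('a::topological_space \<Rightarrow> real) \<Rightarrow> bool" where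
  "upper_semicont f \<longleftrightarrow> (\<forall>a. open {x. f x < a})"

end

(* Rademacher's theorem is not needed: the integrand is minus infinity at points where the map is
   not differentiable, so only the points where a derivative exists have to be controlled.

   (a), (b): For periodic phi, the maps x |-> phi(k x)/k are uniformly Lipschitz, tend to 0 uniformly,
   and have the same gradient range; a map vanishing outside Q extends Q-periodically.

   (c), (d): If xi - eta = a b^T, the map u a, with u(x) a sawtooth in b.x of slopes 1-t and -t,
   moves the matrix t xi + (1-t) eta exactly onto {xi, eta}. This is periodic in a cube with an edge
   parallel to b, and of arbitrarily small amplitude, which settles (d) and the strong case. For (c),
   the infimum of teeth of all scales 2^-k, those of scale 2^-k being penalised by a small multiple of
   (dist(x, complement of Q) - 2^-k)_+, vanishes outside Q and has gradients arbitrarily close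
   to {xi, eta}; upper semicontinuity absorbs the error. *)
theory Submission
  imports Defs
begin

section \<open>Essential suprema through negligible sets\<close>

text \<open>Quantifying over all derivatives \<open>D\<close> makes the condition vacuous where
  \<phi> is not differentiable, in accordance with the value \<open>- \<infinity>\<close> of the
  integrand there.\<close>

definition grad_bounded ::
  "(real^'n^'N \<Rightarrow> real) \<Rightarrow> real^'n^'N \<Rightarrow> (real^'n \<Rightarrow> real^'N) \<Rightarrow> ereal \<Rightarrow> real^'n \<Rightarrow> bool" where
  "grad_bounded f \<xi> \<phi> z x \<longleftrightarrow>
     (\<forall>D. (\<phi> has_derivative D) (at x) \<longrightarrow> ereal (f (\<xi> + matrix D)) \<le> z)"

lemma grad_eq_matrix: "(\<phi> has_derivative D) (at x) \<Longrightarrow> grad \<phi> x = matrix D"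
  unfolding grad_def by (metis frechet_derivative_at)

lemma grad_bounded_iff:
  "grad_bounded f \<xi> \<phi> z x \<longleftrightarrow>
     (if \<phi> differentiable (at x) then ereal (f (\<xi> + grad \<phi> x)) else - \<infinity>) \<le> z"
  unfolding grad_bounded_def differentiable_def by (auto simp: grad_eq_matrix)

text \<open>Negligibility is easy to transport through subsets, countable unions, translations and
  scalings.\<close>

lemma AE_lebesgue_on_iff_negligible:
  fixes S :: "'a::euclidean_space set"
  assumes "S \<in> sets lebesgue"
  shows "(AE x in lebesgue_on S. P x) \<longleftrightarrow> negligible {x \<in> S. \<not> P x}"
proof
  assume "AE x in lebesgue_on S. P x"
  then have "AE x in lebesgue. x \<in> S \<longrightarrow> P x"
    using assms by (subst (asm) AE_restrict_space_iff) auto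
  then obtain N where N: "{x \<in> space lebesgue. \<not> (x \<in> S \<longrightarrow> P x)} \<subseteq> N"
      "emeasure lebesgue N = 0" "N \<in> sets lebesgue"
    by (rule AE_E)
  then have "negligible N" by (simp add: negligible_iff_null_sets null_sets_def)
  then show "negligible {x \<in> S. \<not> P x}" using N(1) by (auto intro: negligible_subset)
next
  assume "negligible {x \<in> S. \<not> P x}"
  then have "{x \<in> S. \<not> P x} \<in> null_sets lebesgue" by (simp add: negligible_iff_null_sets)
  then have "AE x in lebesgue. x \<in> S \<longrightarrow> P x" by (rule AE_I') auto
  then show "AE x in lebesgue_on S. P x"
    using assms by (subst AE_restrict_space_iff) auto
qed

lemma ess_sup_grad_le:
  assumes "S \<in> sets lebesgue" "negligible {x \<in> S. \<not> grad_bounded f \<xi> \<phi> z x}"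
  shows "ess_sup_grad f \<xi> \<phi> S \<le> z"
  using assms unfolding ess_sup_grad_def ess_sup_def
  by (intro Inf_lower) (simp add: AE_lebesgue_on_iff_negligible grad_bounded_iff)

lemma le_ess_sup_grad:
  assumes "S \<in> sets lebesgue"
    and "\<And>z. negligible {x \<in> S. \<not> grad_bounded f \<xi> \<phi> z x} \<Longrightarrow> c \<le> z"
  shows "c \<le> ess_sup_grad f \<xi> \<phi> S"
  unfolding ess_sup_grad_def ess_sup_def
  by (rule Inf_greatest)
     (simp add: AE_lebesgue_on_iff_negligible assms(1) grad_bounded_iff[symmetric] assms(2))

section \<open>Derivative estimates and rank-one matrices\<close>

text \<open>Unit vectors bound each entry by \<open>B\<close>, and sums of entries dominate the
  Euclidean norms. The constant is crude; only its linear dependence on \<open>B\<close>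
  matters.\<close>

lemma norm_matrix_le:
  fixes D :: "real^'n \<Rightarrow> real^'N"
  assumes "\<And>h. norm (D h) \<le> B * norm h"
  shows "norm (matrix D) \<le> real CARD('N) * real CARD('n) * B"
proof -
  have entry: "\<bar>matrix D $ i $ j\<bar> \<le> B" for i j
    using component_le_norm_cart[of "D (axis j 1)" i] assms[of "axis j 1"]
    by (simp add: matrix_def)
  have row: "norm (matrix D $ i) \<le> real CARD('n) * B" for i
  proof -
    have "norm (matrix D $ i) \<le> (\<Sum>j\<in>UNIV. \<bar>matrix D $ i $ j\<bar>)" by (rule norm_le_l1_cart)
    also have "\<dots> \<le> (\<Sum>j\<in>(UNIV::'n set). B)" by (intro sum_mono entry)
    finally show ?thesis by simp
  qed
  have "norm (matrix D) \<le> (\<Sum>i\<in>UNIV. norm (matrix D $ i))"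
    unfolding norm_vec_def by (rule L2_set_le_sum) simp
  also have "\<dots> \<le> (\<Sum>i\<in>(UNIV::'N set). real CARD('n) * B)" by (intro sum_mono row)
  finally show ?thesis by (simp add: mult.assoc)
qed

text \<open>The bound is tested at \<open>x\<close> plus a small positive multiple of
  \<open>h\<close>. All its terms are positively homogeneous in the increment, so the multiple
  cancels.\<close>

lemma derivative_le_of_eventually_le:
  fixes u :: "'a::real_normed_vector \<Rightarrow> real"
  assumes der: "(u has_derivative D) (at x)" and "0 < r" and "linear L"
    and le: "\<And>y. norm (y - x) < r \<Longrightarrow> u y - u x \<le> L (y - x) + \<kappa> * norm (y - x)"
  shows "D h \<le> L h + \<kappa> * norm h"
proof (cases "h = 0")
  case True
  then show ?thesis using der assms(3) by (simp add: linear_0 has_derivative_linear)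
next
  case False
  have linD: "linear D" using der by (rule has_derivative_linear)
  show ?thesis
  proof (rule field_le_epsilon)
    fix e :: real assume "0 < e"
    then have e': "0 < e / norm h" using False by simp
    then obtain d where d: "0 < d"
        "\<And>y. norm (y - x) < d \<Longrightarrow> \<bar>u y - u x - D (y - x)\<bar> \<le> e / norm h * norm (y - x)"
      using der unfolding has_derivative_at_alt real_norm_def by meson
    \<comment> \<open>This puts \<open>y\<close> at distance \<open>min d r / 2\<close> from
      \<open>x\<close>, inside both radii; the tolerance \<open>e / norm h\<close> becomes the error
      bound \<open>s * e\<close>.\<close>
    define s where "s = min d r / (2 * norm h)"
    have s: "0 < s" using d(1) assms(2) False by (simp add: s_def)
    define y where "y = x + s *\<^sub>R h"
    have ny: "norm (y - x) = s * norm h" using s by (simp add: y_def)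
    also have "\<dots> = min d r / 2" using False by (simp add: s_def)
    finally have "norm (y - x) < d" "norm (y - x) < r" using d(1) assms(2) by auto
    then have "D (y - x) \<le> L (y - x) + \<kappa> * norm (y - x) + e / norm h * norm (y - x)"
      using d(2)[of y] le[of y] by linarith
    moreover have "D (y - x) = s * D h" "L (y - x) = s * L h"
      using linD assms(3) by (simp_all add: y_def linear_scale)
    ultimately have "s * D h \<le> s * (L h + \<kappa> * norm h + e)"
      using False by (simp add: ny algebra_simps)
    then show "D h \<le> L h + \<kappa> * norm h + e" using s by simp
  qed
qed

text \<open>The range is a line spanned by some \<open>v\<close>, and pairing with \<open>v\<close>
  reads off the coefficient of \<open>A *v h\<close>. Normalising \<open>b\<close> lets it later
  serve as a column of an orthogonal matrix.\<close>

lemma rank_one_decomposition: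
  fixes A :: "real^'n^'N"
  assumes "rank A = 1"
  obtains a :: "real^'N" and b :: "real^'n" where "a \<noteq> 0" "norm b = 1" "\<And>h. A *v h = (b \<bullet> h) *\<^sub>R a"
proof -
  have "dim (range ((*v) A)) = 1" using assms by (simp add: rank_dim_range)
  then obtain B where B: "B \<subseteq> range ((*v) A)" "independent B" "range ((*v) A) \<subseteq> span B" "card B = 1"
    using basis_exists[of "range ((*v) A)"] by metis
  obtain v where v: "B = {v}" using B(4) by (auto simp: card_1_singleton_iff)
  have v0: "v \<noteq> 0" using B(2) v by auto
  define w where "w = transpose A *v v"
  have eq: "A *v h = ((w \<bullet> h) / (v \<bullet> v)) *\<^sub>R v" for h
  proof -
    obtain k where k: "A *v h = k *\<^sub>R v" using B(3) v by (auto simp: span_singleton)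
    have "w \<bullet> h = v \<bullet> (A *v h)" unfolding w_def by (simp add: dot_lmul_matrix transpose_matrix_vector)
    then show ?thesis using k v0 by simp
  qed
  have w0: "w \<noteq> 0" using B(1) v v0 eq by auto
  show thesis
  proof
    show "(norm w / (v \<bullet> v)) *\<^sub>R v \<noteq> 0" using v0 w0 by simp
    show "norm ((1 / norm w) *\<^sub>R w) = 1" using w0 by simp
    show "A *v h = ((1 / norm w) *\<^sub>R w \<bullet> h) *\<^sub>R (norm w / (v \<bullet> v)) *\<^sub>R v" for h
      using w0 by (simp add: eq)
  qed
qed

section \<open>Teeth and their lower envelopes\<close>

text \<open>The slopes are dictated by the target matrices: adding g (\<xi> - \<eta>) to t \<xi> +
  (1 - t) \<eta> gives \<xi> for g = 1 - t and \<eta> for g = - t.\<close>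

definition tooth :: "real \<Rightarrow> real \<Rightarrow> real" where
  "tooth t s = max ((1 - t) * s) (- t * s)"

text \<open>A lower envelope of translated teeth. Touching it from above by the tooth that attains the
  infimum at a point shows that the gradient there is within \<open>\<kappa>\<close> of \<open>(1 - t) b\<close> or \<open>- t b\<close>, where
  \<open>\<kappa>\<close> is a Lipschitz constant of the offsets \<open>\<tau>\<close>.\<close>

definition laminate ::
  "real \<Rightarrow> 'a::real_inner \<Rightarrow> ('i \<Rightarrow> real) \<Rightarrow> ('i \<Rightarrow> 'a \<Rightarrow> real) \<Rightarrow> 'a \<Rightarrow> real" where
  "laminate t b p \<tau> x = (INF i. \<tau> i x + tooth t (b \<bullet> x - p i))"

context
  fixes t :: real
  assumes t: "0 < t" "t < 1"
begin

lemma tooth_pos: "0 \<le> s \<Longrightarrow> tooth t s = (1 - t) * s"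
  unfolding tooth_def by (intro max_absorb1) (simp add: algebra_simps)

lemma tooth_neg: "s \<le> 0 \<Longrightarrow> tooth t s = - t * s"
  unfolding tooth_def by (intro max_absorb2) (simp add: algebra_simps)

lemma tooth_nonneg: "0 \<le> tooth t s"
  using t by (cases "s \<ge> 0") (auto simp: tooth_pos tooth_neg mult_nonneg_nonpos)

text \<open>Coercivity: this leaves only finitely many teeth of a given spacing below any
  level.\<close>

lemma tooth_ge: "min t (1 - t) * \<bar>s\<bar> \<le> tooth t s"
  using t by (cases "s \<ge> 0") (auto simp: tooth_pos tooth_neg min_def mult_right_mono mult_right_mono_neg)

lemma tooth_lipschitz: "\<bar>tooth t s - tooth t s'\<bar> \<le> \<bar>s - s'\<bar>"
proof -
  have 1: "\<bar>(1-t) * s - (1-t) * s'\<bar> \<le> \<bar>s - s'\<bar>"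
    using t by (simp add: right_diff_distrib[symmetric] abs_mult mult_left_le_one_le)
  have 2: "\<bar>- t * s - - t * s'\<bar> \<le> \<bar>s - s'\<bar>"
    using t abs_mult[of t "s - s'"] by (simp add: right_diff_distrib mult_left_le_one_le abs_minus_commute)
  show ?thesis using 1 2 unfolding tooth_def max_def by (auto split: if_splits)
qed

lemma tooth_le_abs: "tooth t s \<le> \<bar>s\<bar>"
  using tooth_lipschitz[of s 0] tooth_nonneg[of s] by (simp add: tooth_pos)

lemma finite_tooth_sublevel:
  assumes "0 < \<delta>"
  shows "finite {j::int. tooth t (s - \<delta> * of_int j) \<le> v}"
proof -
  define m where "m = min t (1 - t)"
  have m: "0 < m" using t by (simp add: m_def)
  define R where "R = (\<bar>s\<bar> + v / m) / \<delta>"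
  have "{j::int. tooth t (s - \<delta> * of_int j) \<le> v} \<subseteq> {\<lfloor>- R\<rfloor>..\<lceil>R\<rceil>}"
  proof clarify
    fix j :: int assume "tooth t (s - \<delta> * of_int j) \<le> v"
    then have "m * \<bar>s - \<delta> * of_int j\<bar> \<le> v" using tooth_ge[of "s - \<delta> * of_int j"] unfolding m_def by linarith
    then have "\<bar>s - \<delta> * of_int j\<bar> \<le> v / m" using m by (simp add: field_simps)
    then have "\<delta> * \<bar>of_int j\<bar> \<le> \<bar>s\<bar> + v / m" using assms by (simp add: abs_mult[symmetric])
    then have "\<bar>of_int j\<bar> \<le> R" using assms by (simp add: R_def field_simps)
    then show "j \<in> {\<lfloor>- R\<rfloor>..\<lceil>R\<rceil>}" by (simp add: abs_le_iff) linarith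
  qed
  then show ?thesis using finite_subset by blast
qed

text \<open>The node obtained by rounding \<open>s / \<delta>\<close> down lies within \<delta> of
  \<open>s\<close>, and a tooth never exceeds the distance to its node.\<close>

lemma tooth_near_int_multiple:
  assumes "0 < \<delta>"
  shows "\<exists>j::int. tooth t (s - \<delta> * of_int j) \<le> \<delta>"
proof -
  have "s / \<delta> - of_int \<lfloor>s / \<delta>\<rfloor> \<in> {0..1}" by simp linarith
  then have "\<bar>s - \<delta> * of_int \<lfloor>s / \<delta>\<rfloor>\<bar> \<le> \<delta>" using assms by (auto simp: field_simps)
  then show ?thesis using tooth_le_abs order_trans by blast
qed

context
  fixes b :: "'a::euclidean_space" and p :: "'i \<Rightarrow> real" and \<tau> :: "'i \<Rightarrow> 'a \<Rightarrow> real" and \<kappa> :: real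
  assumes \<kappa>: "0 \<le> \<kappa>"
    and \<tau>_nonneg: "\<And>i x. 0 \<le> \<tau> i x"
    and \<tau>_lip: "\<And>i x y. \<bar>\<tau> i x - \<tau> i y\<bar> \<le> \<kappa> * norm (x - y)"
begin

lemma laminate_le: "laminate t b p \<tau> x \<le> \<tau> i x + tooth t (b \<bullet> x - p i)"
  unfolding laminate_def
  by (rule cINF_lower) (auto intro!: bdd_belowI2[of _ 0] add_nonneg_nonneg \<tau>_nonneg tooth_nonneg)

lemma laminate_nonneg: "0 \<le> laminate t b p \<tau> x"
  unfolding laminate_def by (rule cINF_greatest) (auto intro!: add_nonneg_nonneg \<tau>_nonneg tooth_nonneg)

text \<open>Every branch has this Lipschitz constant, and an infimum preserves a common
  constant.\<close>

lemma laminate_lipschitz: "(\<kappa> + norm b)-lipschitz_on UNIV (laminate t b p \<tau>)"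
proof -
  have half: "laminate t b p \<tau> x \<le> laminate t b p \<tau> y + (\<kappa> + norm b) * norm (x - y)" for x y
  proof -
    have "laminate t b p \<tau> x - (\<kappa> + norm b) * norm (x - y) \<le> \<tau> i y + tooth t (b \<bullet> y - p i)" for i
    proof -
      have "\<bar>b \<bullet> x - p i - (b \<bullet> y - p i)\<bar> \<le> norm b * norm (x - y)"
        using Cauchy_Schwarz_ineq2[of b "x - y"] by (simp add: inner_diff_right)
      then show ?thesis
        using laminate_le[of x i] \<tau>_lip[of i x y] tooth_lipschitz[of "b \<bullet> x - p i" "b \<bullet> y - p i"]
        by (simp add: distrib_right)
    qed
    then have "laminate t b p \<tau> x - (\<kappa> + norm b) * norm (x - y) \<le> laminate t b p \<tau> y"
      unfolding laminate_def[of t b p \<tau> y] by (intro cINF_greatest) auto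
    then show ?thesis by simp
  qed
  show ?thesis
  proof (rule lipschitz_onI)
    show "0 \<le> \<kappa> + norm b" using \<kappa> by simp
    show "dist (laminate t b p \<tau> x) (laminate t b p \<tau> y) \<le> (\<kappa> + norm b) * dist x y" for x y
      using half[of x y] half[of y x] by (simp add: dist_norm norm_minus_commute abs_le_iff)
  qed
qed

text \<open>At \<open>x\<close> the envelope meets the branch \<open>i\<close> and elsewhere it
  stays below, which bounds its increments from above. Linearity of \<open>D\<close>, used at
  \<open>h\<close> and \<open>- h\<close>, makes the bound two-sided.\<close>

lemma laminate_derivative:
  assumes opt: "\<And>j. \<tau> i x + tooth t (b \<bullet> x - p i) \<le> \<tau> j x + tooth t (b \<bullet> x - p j)"
    and off: "b \<bullet> x \<noteq> p i"
    and der: "(laminate t b p \<tau> has_derivative D) (at x)"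
  shows "\<exists>g\<in>{1 - t, - t}. \<forall>h. \<bar>D h - g * (b \<bullet> h)\<bar> \<le> \<kappa> * norm h"
proof -
  define s where "s = b \<bullet> x - p i"
  define g where "g = (if s > 0 then 1 - t else - t)"
  have s0: "s \<noteq> 0" using off by (simp add: s_def)
  have lam: "laminate t b p \<tau> x = \<tau> i x + tooth t s"
    using laminate_le[of x i] opt unfolding laminate_def s_def
    by (intro antisym cINF_greatest) auto
  have tooth_g: "tooth t s' = g * s'" if "\<bar>s' - s\<bar> < \<bar>s\<bar>" for s'
    using that s0 by (cases "0 < s") (auto simp: g_def tooth_pos tooth_neg)
  \<comment> \<open>Within this radius \<open>b \<bullet> y - p i\<close> keeps the sign of
    \<open>s\<close>, so the tooth is linear there; the \<open>+ 1\<close> avoids division by zero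
    if \<open>b = 0\<close>.\<close>
  define r where "r = \<bar>s\<bar> / (norm b + 1)"
  have r: "0 < r" using s0 by (simp add: r_def add_nonneg_pos)
  have le: "laminate t b p \<tau> y - laminate t b p \<tau> x \<le> g * (b \<bullet> (y - x)) + \<kappa> * norm (y - x)"
    if y: "norm (y - x) < r" for y
  proof -
    have nb: "0 < norm b + 1" by (simp add: add_nonneg_pos)
    have "\<bar>b \<bullet> (y - x)\<bar> \<le> norm b * norm (y - x)" by (rule Cauchy_Schwarz_ineq2)
    also have "\<dots> \<le> (norm b + 1) * norm (y - x)" by (simp add: mult_right_mono)
    also have "\<dots> < \<bar>s\<bar>" using y nb by (simp add: r_def field_simps)
    finally have "tooth t (b \<bullet> y - p i) = g * (b \<bullet> y - p i)"
      by (intro tooth_g) (simp add: s_def inner_diff_right)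
    moreover have "tooth t s = g * s" using s0 by (intro tooth_g) simp
    moreover have "\<tau> i y - \<tau> i x \<le> \<kappa> * norm (y - x)" using \<tau>_lip[of i y x] by linarith
    ultimately show ?thesis
      using laminate_le[of y i] unfolding lam by (simp add: s_def inner_diff_right algebra_simps)
  qed
  have linL: "linear (\<lambda>h. g * (b \<bullet> h))"
    by (auto intro!: linearI simp: inner_add_right distrib_left)
  have up: "D h \<le> g * (b \<bullet> h) + \<kappa> * norm h" for h
    using derivative_le_of_eventually_le[OF der r linL le] .
  have "linear D" using der by (rule has_derivative_linear)
  then have "\<bar>D h - g * (b \<bullet> h)\<bar> \<le> \<kappa> * norm h" for h
    using up[of h] up[of "- h"] by (simp add: linear_neg)
  moreover have "g \<in> {1 - t, - t}" by (simp add: g_def)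
  ultimately show ?thesis by blast
qed

end

text \<open>The kinks of the teeth lie on countably many hyperplanes
  \<open>b \<bullet> x = p i\<close>, together negligible. Elsewhere the branch attaining the
  infimum fixes the gradient up to a multiple of \<kappa>.\<close>

lemma laminate_gradient:
  fixes a :: "real^'N" and b :: "real^'n" and p :: "'i::countable \<Rightarrow> real"
  assumes "0 \<le> \<kappa>" and "\<And>i x. 0 \<le> \<tau> i x" and "\<And>i x y. \<bar>\<tau> i x - \<tau> i y\<bar> \<le> \<kappa> * norm (x - y)"
    and a: "a \<noteq> 0" and b: "b \<noteq> 0" and A: "\<And>h. A *v h = (b \<bullet> h) *\<^sub>R a"
    and opt: "\<And>x. x \<in> S \<Longrightarrow> \<exists>i. \<forall>j. \<tau> i x + tooth t (b \<bullet> x - p i) \<le> \<tau> j x + tooth t (b \<bullet> x - p j)"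
  shows "negligible {x \<in> S. \<not> (\<forall>D. ((\<lambda>x. laminate t b p \<tau> x *\<^sub>R a) has_derivative D) (at x) \<longrightarrow>
           (\<exists>g\<in>{1 - t, - t}. norm (matrix D - g *\<^sub>R A) \<le> real CARD('N) * real CARD('n) * (\<kappa> * norm a)))}"
    (is "negligible ?N")
proof (rule negligible_subset)
  show "negligible (\<Union>i. {x. b \<bullet> x = p i})"
    by (intro negligible_countable_Union) (auto simp: b negligible_hyperplane)
  show "?N \<subseteq> (\<Union>i. {x. b \<bullet> x = p i})"
  proof (rule ccontr)
    assume "\<not> ?thesis"
    then obtain x D where x: "x \<in> S" and off: "\<And>i. b \<bullet> x \<noteq> p i"
      and der: "((\<lambda>x. laminate t b p \<tau> x *\<^sub>R a) has_derivative D) (at x)"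
      and neg: "\<not> (\<exists>g\<in>{1 - t, - t}. norm (matrix D - g *\<^sub>R A) \<le> real CARD('N) * real CARD('n) * (\<kappa> * norm a))"
      by blast
    obtain i where i: "\<And>j. \<tau> i x + tooth t (b \<bullet> x - p i) \<le> \<tau> j x + tooth t (b \<bullet> x - p j)"
      using opt[OF x] by blast
    have aa: "a \<bullet> a \<noteq> 0" using a by simp
    \<comment> \<open>Pairing with \<open>a\<close> recovers the scalar envelope, so a derivative of
      the vector map yields one of \<open>laminate\<close>.\<close>
    define D' where "D' h = (D h \<bullet> a) / (a \<bullet> a)" for h
    have der': "(laminate t b p \<tau> has_derivative D') (at x)"
      using has_derivative_mult_right[OF has_derivative_inner_left[OF der, of a], of "1 / (a \<bullet> a)"] aa
      by (simp add: D'_def[abs_def])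
    have "((\<lambda>x. laminate t b p \<tau> x *\<^sub>R a) has_derivative (\<lambda>h. D' h *\<^sub>R a)) (at x)"
      using has_derivative_scaleR_left[OF der'] .
    then have D: "D = (\<lambda>h. D' h *\<^sub>R a)" using der has_derivative_unique by blast
    obtain g where g: "g \<in> {1 - t, - t}" "\<And>h. \<bar>D' h - g * (b \<bullet> h)\<bar> \<le> \<kappa> * norm h"
      using laminate_derivative[of \<kappa> \<tau>, OF assms(1-3) i off der'] by blast
    have eq: "matrix D - g *\<^sub>R A = matrix (\<lambda>h. D h - g *\<^sub>R (A *v h))"
      by (simp add: vec_eq_iff matrix_def matrix_vector_mult_basis column_def)
    have "norm (matrix D - g *\<^sub>R A) \<le> real CARD('N) * real CARD('n) * (\<kappa> * norm a)"
      unfolding eq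
    proof (rule norm_matrix_le)
      fix h
      have "D h - g *\<^sub>R (A *v h) = (D' h - g * (b \<bullet> h)) *\<^sub>R a" by (simp add: D A algebra_simps)
      then show "norm (D h - g *\<^sub>R (A *v h)) \<le> \<kappa> * norm a * norm h"
        using mult_right_mono[OF g(2)[of h] norm_ge_zero[of a]] by (simp add: mult_ac)
    qed
    then show False using neg g(1) by blast
  qed
qed

end


section \<open>Gradient bounds for Lipschitz maps and for envelopes\<close>

lemma lipschitz_imp_norm_grad_le:
  fixes \<phi> :: "real^'n \<Rightarrow> real^'N"
  assumes lip: "L-lipschitz_on UNIV \<phi>" and "\<phi> differentiable (at x)"
  shows "norm (grad \<phi> x) \<le> real CARD('N) * real CARD('n) * L"
proof -
  obtain D where D: "(\<phi> has_derivative D) (at x)"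
    using assms(2) by (auto simp: differentiable_def)
  have "norm (D h) \<le> L * norm h" for h
  proof -
    \<comment> \<open>Testing against \<open>D h\<close> itself bounds the square of
      \<open>norm (D h)\<close> by \<open>L * norm (D h) * norm h\<close>, and one factor
      cancels.\<close>
    have der: "((\<lambda>y. \<phi> y \<bullet> D h) has_derivative (\<lambda>k. D k \<bullet> D h)) (at x)"
      using D by (rule has_derivative_inner_left)
    have "\<phi> y \<bullet> D h - \<phi> x \<bullet> D h \<le> 0 + (L * norm (D h)) * norm (y - x)" for y
    proof -
      have "(\<phi> y - \<phi> x) \<bullet> D h \<le> norm (\<phi> y - \<phi> x) * norm (D h)" by (rule norm_cauchy_schwarz)
      also have "\<dots> \<le> (L * norm (y - x)) * norm (D h)"
        using lipschitz_onD[OF lip, of y x] by (intro mult_right_mono) (auto simp: dist_norm)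
      finally show ?thesis by (simp add: inner_diff_left mult_ac)
    qed
    then have "D h \<bullet> D h \<le> 0 + (L * norm (D h)) * norm h"
      using derivative_le_of_eventually_le[OF der, of 1 "\<lambda>_. 0" "L * norm (D h)" h]
      by (simp add: linear_iff)
    then have "norm (D h) * norm (D h) \<le> norm (D h) * (L * norm h)"
      by (simp add: dot_square_norm power2_eq_square mult_ac)
    then show ?thesis
      using lipschitz_on_nonneg[OF lip] by (cases "D h = 0") (auto simp: mult_nonneg_nonneg)
  qed
  then show ?thesis using norm_matrix_le[of D L] by (simp add: grad_eq_matrix[OF D])
qed

text \<open>Only indices whose value does not exceed that of \<open>i0\<close> compete, so a finite
  minimum decides.\<close>

lemma minimum_attained:
  fixes v :: "'i \<Rightarrow> real"
  assumes "finite {i. v i \<le> v i0}"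
  shows "\<exists>i. \<forall>j. v i \<le> v j"
proof -
  let ?S = "{i. v i \<le> v i0}"
  have "Min (v ` ?S) \<in> v ` ?S" using assms by (intro Min_in) auto
  then obtain i where i: "v i \<le> v i0" "v i = Min (v ` ?S)" by auto
  have "v i \<le> v j" if "v j \<le> v i0" for j
    unfolding i(2) using assms that by (intro Min_le) auto
  with i(1) show ?thesis by (metis linorder_le_cases order_trans)
qed

text \<open>The gradient of the map is close to g (\<xi> - \<eta>), so the full matrix is close to
  \<xi> or \<eta>. The hypotheses \<open>f\<close> control the function on just these two balls,
  which are points when \<kappa> = 0.\<close>

lemma laminate_grad_bounded:
  fixes a :: "real^'N" and b :: "real^'n" and p :: "'i::countable \<Rightarrow> real"
  assumes t: "0 < t" "t < 1"
    and \<tau>: "0 \<le> \<kappa>" "\<And>i x. 0 \<le> \<tau> i x" "\<And>i x y. \<bar>\<tau> i x - \<tau> i y\<bar> \<le> \<kappa> * norm (x - y)"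
    and ab: "a \<noteq> 0" "b \<noteq> 0" "\<And>h. (\<xi> - \<eta>) *v h = (b \<bullet> h) *\<^sub>R a"
    and opt: "\<And>x. x \<in> S \<Longrightarrow> \<exists>i. \<forall>j. \<tau> i x + tooth t (b \<bullet> x - p i) \<le> \<tau> j x + tooth t (b \<bullet> x - p j)"
    and f: "\<And>X. norm (X - \<xi>) \<le> real CARD('N) * real CARD('n) * (\<kappa> * norm a) \<Longrightarrow> f X \<le> z"
           "\<And>X. norm (X - \<eta>) \<le> real CARD('N) * real CARD('n) * (\<kappa> * norm a) \<Longrightarrow> f X \<le> z"
  shows "negligible {x \<in> S. \<not> grad_bounded f (t *\<^sub>R \<xi> + (1 - t) *\<^sub>R \<eta>)
           (\<lambda>x. laminate t b p \<tau> x *\<^sub>R a) (ereal z) x}"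
proof (rule negligible_subset[OF laminate_gradient[of t, OF t \<tau> ab opt]])
  let ?X = "t *\<^sub>R \<xi> + (1 - t) *\<^sub>R \<eta>"
  have bound: "f (?X + M) \<le> z"
    if "\<exists>g\<in>{1 - t, - t}. norm (M - g *\<^sub>R (\<xi> - \<eta>)) \<le> real CARD('N) * real CARD('n) * (\<kappa> * norm a)" for M
  proof -
    have "M - (1 - t) *\<^sub>R (\<xi> - \<eta>) = (?X + M) - \<xi>" "M - (- t) *\<^sub>R (\<xi> - \<eta>) = (?X + M) - \<eta>"
      by (simp_all add: algebra_simps)
    then show ?thesis using that f[of "?X + M"] by (metis insertE singletonD)
  qed
  show "{x \<in> S. \<not> grad_bounded f ?X (\<lambda>x. laminate t b p \<tau> x *\<^sub>R a) (ereal z) x} \<subseteq>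
    {x \<in> S. \<not> (\<forall>D. ((\<lambda>x. laminate t b p \<tau> x *\<^sub>R a) has_derivative D) (at x) \<longrightarrow>
           (\<exists>g\<in>{1 - t, - t}. norm (matrix D - g *\<^sub>R (\<xi> - \<eta>)) \<le> real CARD('N) * real CARD('n) * (\<kappa> * norm a)))}"
    unfolding grad_bounded_def using bound by (simp only: ereal_less_eq) blast
qed

lemma lipschitz_scaleR_vector:
  assumes "L-lipschitz_on S u"
  shows "(L * norm a)-lipschitz_on S (\<lambda>x. u x *\<^sub>R a)"
proof (rule lipschitz_onI)
  show "0 \<le> L * norm a" using lipschitz_on_nonneg[OF assms] by simp
  show "dist (u x *\<^sub>R a) (u y *\<^sub>R a) \<le> L * norm a * dist x y" if "x \<in> S" "y \<in> S" for x y
    using mult_right_mono[OF lipschitz_onD[OF assms that] norm_ge_zero[of a]]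
    by (simp add: dist_norm scaleR_diff_left[symmetric] mult_ac)
qed

section \<open>Sawtooth functions with equally spaced nodes\<close>

abbreviation sawtooth :: "real \<Rightarrow> 'a::real_inner \<Rightarrow> real \<Rightarrow> 'a \<Rightarrow> real" where
  "sawtooth t b \<delta> \<equiv> laminate t b (\<lambda>j::int. \<delta> * of_int j) (\<lambda>_ _. 0)"

lemma sawtooth_lipschitz:
  fixes b :: "'a::euclidean_space"
  assumes "0 < t" "t < 1"
  shows "(norm b)-lipschitz_on UNIV (sawtooth t b \<delta>)"
  using laminate_lipschitz[OF assms, of 0 "\<lambda>_ _. 0" b] by simp

lemma sawtooth_bounds:
  fixes b :: "'a::euclidean_space"
  assumes "0 < t" "t < 1" "0 < \<delta>"
  shows "0 \<le> sawtooth t b \<delta> x" "sawtooth t b \<delta> x \<le> \<delta>"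
proof -
  show "0 \<le> sawtooth t b \<delta> x" by (rule laminate_nonneg[OF assms(1,2), of 0]) auto
  obtain j :: int where "tooth t (b \<bullet> x - \<delta> * of_int j) \<le> \<delta>"
    using tooth_near_int_multiple[OF assms] by blast
  then show "sawtooth t b \<delta> x \<le> \<delta>"
    using laminate_le[OF assms(1,2), of 0 "\<lambda>_ _. 0" b "\<lambda>j::int. \<delta> * of_int j" x j] by auto
qed

text \<open>The translation shifts the argument by \<open>m\<close> spacings, which merely renumbers
  the teeth.\<close>

lemma sawtooth_periodic:
  assumes "b \<bullet> w = \<delta> * of_int m"
  shows "sawtooth t b \<delta> (x + w) = sawtooth t b \<delta> x"
proof -
  have "range (\<lambda>j::int. tooth t (b \<bullet> (x + w) - \<delta> * of_int j)) = range (\<lambda>j::int. tooth t (b \<bullet> x - \<delta> * of_int j))"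
    (is "range ?F = range ?G")
  proof -
    have "?F = ?G \<circ> (\<lambda>j. j - m)"
      by (auto simp: fun_eq_iff inner_add_right assms algebra_simps)
    moreover have "surj (\<lambda>j::int. j - m)" by (metis add_diff_cancel surjI)
    ultimately show ?thesis by (simp only: image_comp[symmetric])
  qed
  then show ?thesis by (simp add: laminate_def)
qed

text \<open>Zero offsets allow \<kappa> = 0, so that only the values of \<open>f\<close> at \<xi>
  and \<eta> themselves enter.\<close>

lemma sawtooth_grad_bounded:
  fixes a :: "real^'N" and b :: "real^'n"
  assumes t: "0 < t" "t < 1" and "0 < \<delta>"
    and ab: "a \<noteq> 0" "b \<noteq> 0" "\<And>h. (\<xi> - \<eta>) *v h = (b \<bullet> h) *\<^sub>R a"
  shows "negligible {x \<in> S. \<not> grad_bounded f (t *\<^sub>R \<xi> + (1 - t) *\<^sub>R \<eta>)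
           (\<lambda>x. sawtooth t b \<delta> x *\<^sub>R a) (ereal (max (f \<xi>) (f \<eta>))) x}"
proof (rule laminate_grad_bounded[where \<kappa> = 0])
  show "\<exists>i. \<forall>j. 0 + tooth t (b \<bullet> x - \<delta> * real_of_int i) \<le> 0 + tooth t (b \<bullet> x - \<delta> * real_of_int j)" for x
    by (rule minimum_attained[where ?i0.0 = 0]) (use finite_tooth_sublevel[OF t assms(3)] in simp)
qed (use assms in auto)

section \<open>Cubes, and rank-one convexity through sawtooth maps\<close>

lemma unit_cube_iff: "x \<in> unit_cube \<longleftrightarrow> (\<forall>i. - 1/2 < x $ i \<and> x $ i < 1/2)"
  by (auto simp: unit_cube_def mem_box_cart)

lemma unit_cube_lebesgue: "unit_cube \<in> sets lebesgue"
  by (simp add: unit_cube_def)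

lemma cube_lebesgue: "cube 0 r R \<in> sets lebesgue"
proof -
  have "(*v) R ` box (\<chi> i. - r/2) (\<chi> i. r/2) \<in> sets lebesgue"
    by (intro differentiable_image_in_sets_lebesgue linear_imp_differentiable_on
        matrix_vector_mul_linear) auto
  then show ?thesis by (simp add: cube_def)
qed

lemma periodic_weak_MQC_in_imp_rank_one_convex:
  fixes f :: "real^'n^'N \<Rightarrow> real"
  assumes per: "\<And>c r R. 0 < r \<Longrightarrow> orthogonal_matrix R \<Longrightarrow> periodic_weak_MQC_in c r R f"
  shows "rank_one_convex f"
  unfolding rank_one_convex_def
proof (intro allI impI)
  fix \<xi> \<eta> :: "real^'n^'N" and t :: real
  assume h: "rank (\<xi> - \<eta>) = 1 \<and> 0 < t \<and> t < 1"
  then have t: "0 < t" "t < 1" by auto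
  obtain a :: "real^'N" and b :: "real^'n" where ab: "a \<noteq> 0" "norm b = 1" "\<And>h. (\<xi> - \<eta>) *v h = (b \<bullet> h) *\<^sub>R a"
    using rank_one_decomposition h by blast
  then have b0: "b \<noteq> 0" by auto
  \<comment> \<open>Completing \<open>b\<close> to an orthonormal frame gives a unit cube with one
    edge parallel to \<open>b\<close>.\<close>
  obtain R and k :: 'n where R: "orthogonal_matrix R" "R *v axis k 1 = b"
    using orthogonal_matrix_exists_basis[OF ab(2)] by blast
  have b: "b = column k R" using R(2) by (simp add: matrix_vector_mult_basis)
  define \<phi> where "\<phi> x = sawtooth t b 1 x *\<^sub>R a" for x
  have "\<phi> \<in> W1inf_per 0 1 R"
    unfolding W1inf_per_def
  proof (intro CollectI conjI allI)
    show "\<exists>L. L-lipschitz_on UNIV \<phi>"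
      unfolding \<phi>_def by (intro exI[of _ "norm b * norm a"] lipschitz_scaleR_vector sawtooth_lipschitz t)
    show "bounded (range \<phi>)"
      using sawtooth_bounds[OF t zero_less_one, of b]
      by (intro boundedI[of _ "norm a"]) (auto simp: \<phi>_def mult_left_le_one_le)
    fix x i
    \<comment> \<open>Edge \<open>k\<close> advances the sawtooth by one spacing; the other edges
      are orthogonal to \<open>b\<close> and leave it unchanged.\<close>
    have "b \<bullet> column i R = 1 * of_int (if i = k then 1 else 0)"
      using R(1) ab(2) unfolding orthogonal_matrix_orthonormal_columns b
      by (auto simp: orthogonal_def dot_square_norm)
    then show "\<phi> (x + 1 *\<^sub>R column i R) = \<phi> x"
      by (simp only: \<phi>_def scaleR_one sawtooth_periodic)
  qed
  then have "ereal (f (t *\<^sub>R \<xi> + (1 - t) *\<^sub>R \<eta>)) \<le> ess_sup_grad f (t *\<^sub>R \<xi> + (1 - t) *\<^sub>R \<eta>) \<phi> (cube 0 1 R)"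
    using per[OF zero_less_one R(1)] unfolding periodic_weak_MQC_in_def by blast
  also have "\<dots> \<le> ereal (max (f \<xi>) (f \<eta>))"
    unfolding \<phi>_def
    by (intro ess_sup_grad_le cube_lebesgue sawtooth_grad_bounded t zero_less_one ab b0)
  finally show "f (t *\<^sub>R \<xi> + (1 - t) *\<^sub>R \<eta>) \<le> max (f \<xi>) (f \<eta>)" by (simp del: ereal_max)
qed

text \<open>A Lipschitz constant bounds the gradient, so a single \<delta> serves all maps with
  constant \<open>L\<close>, and the map can be chosen after \<delta>.\<close>

lemma strong_MQC_uniform:
  fixes f :: "real^'n^'N \<Rightarrow> real"
  assumes "strong_MQC f" "0 < \<epsilon>"
  shows "\<exists>\<delta>>0. \<forall>\<phi>. L-lipschitz_on UNIV \<phi> \<longrightarrow> (\<forall>x. norm (\<phi> x) \<le> \<delta>) \<longrightarrow>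
       ereal (f \<xi>) \<le> ess_sup_grad f \<xi> \<phi> unit_cube + ereal \<epsilon>"
proof -
  \<comment> \<open>The summand 1 makes \<open>K\<close> positive, and the modulus covers negative
    \<open>L\<close>, for which no map is \<open>L\<close>-Lipschitz.\<close>
  define K where "K = real CARD('N) * real CARD('n) * \<bar>L\<bar> + 1"
  have "0 < K" unfolding K_def by (intro add_nonneg_pos mult_nonneg_nonneg) auto
  then obtain \<delta> where \<delta>: "0 < \<delta>" "\<forall>\<phi>. (\<exists>L. L-lipschitz_on (closure unit_cube) \<phi>) \<and>
     (AE x in lebesgue_on unit_cube. \<phi> differentiable (at x) \<longrightarrow> norm (grad \<phi> x) \<le> K) \<and>
     (\<forall>x\<in>frontier unit_cube. norm (\<phi> x) \<le> \<delta>) \<longrightarrow>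
     ereal (f \<xi>) \<le> ess_sup_grad f \<xi> \<phi> unit_cube + ereal \<epsilon>"
    using assms(1)[unfolded strong_MQC_def, rule_format, OF assms(2), of K \<xi>] by blast
  show ?thesis
  proof (intro exI[of _ \<delta>] conjI allI impI)
    show "0 < \<delta>" by (rule \<delta>(1))
    fix \<phi> :: "real^'n \<Rightarrow> real^'N"
    assume lip: "L-lipschitz_on UNIV \<phi>" and small: "\<forall>x. norm (\<phi> x) \<le> \<delta>"
    have "\<exists>L. L-lipschitz_on (closure unit_cube) \<phi>"
      using lipschitz_on_subset[OF lip] by blast
    moreover have "norm (grad \<phi> x) \<le> K" if "\<phi> differentiable (at x)" for x
      using lipschitz_imp_norm_grad_le[OF lip that] lipschitz_on_nonneg[OF lip] unfolding K_def by simp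
    then have "AE x in lebesgue_on unit_cube. \<phi> differentiable (at x) \<longrightarrow> norm (grad \<phi> x) \<le> K"
      by simp
    ultimately show "ereal (f \<xi>) \<le> ess_sup_grad f \<xi> \<phi> unit_cube + ereal \<epsilon>"
      using small by (intro \<delta>(2)[rule_format] conjI) auto
  qed
qed

lemma strong_MQC_imp_rank_one_convex:
  fixes f :: "real^'n^'N \<Rightarrow> real"
  assumes strong: "strong_MQC f"
  shows "rank_one_convex f"
  unfolding rank_one_convex_def
proof (intro allI impI)
  fix \<xi> \<eta> :: "real^'n^'N" and t :: real
  assume h: "rank (\<xi> - \<eta>) = 1 \<and> 0 < t \<and> t < 1"
  then have t: "0 < t" "t < 1" by auto
  obtain a :: "real^'N" and b :: "real^'n" where ab: "a \<noteq> 0" "norm b = 1" "\<And>h. (\<xi> - \<eta>) *v h = (b \<bullet> h) *\<^sub>R a"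
    using rank_one_decomposition h by blast
  then have b0: "b \<noteq> 0" by auto
  let ?X = "t *\<^sub>R \<xi> + (1 - t) *\<^sub>R \<eta>"
  show "f ?X \<le> max (f \<xi>) (f \<eta>)"
  proof (rule field_le_epsilon)
    fix \<epsilon> :: real assume "0 < \<epsilon>"
    then obtain \<delta> where \<delta>: "0 < \<delta>"
      "\<forall>\<phi>. (norm b * norm a)-lipschitz_on UNIV \<phi> \<longrightarrow> (\<forall>x. norm (\<phi> x) \<le> \<delta>) \<longrightarrow>
         ereal (f ?X) \<le> ess_sup_grad f ?X \<phi> unit_cube + ereal \<epsilon>"
      using strong_MQC_uniform[OF strong, of \<epsilon> "norm b * norm a" ?X] by blast
    \<comment> \<open>The spacing bounds the amplitude of the sawtooth but does not enter its
      Lipschitz constant, so it may depend on \<delta>.\<close>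
    have d: "0 < \<delta> / norm a" using \<delta>(1) ab(1) by simp
    define \<phi> where "\<phi> x = sawtooth t b (\<delta> / norm a) x *\<^sub>R a" for x
    have "ereal (f ?X) \<le> ess_sup_grad f ?X \<phi> unit_cube + ereal \<epsilon>"
    proof (intro \<delta>(2)[rule_format])
      show "(norm b * norm a)-lipschitz_on UNIV \<phi>"
        unfolding \<phi>_def by (intro lipschitz_scaleR_vector sawtooth_lipschitz t)
      show "norm (\<phi> x) \<le> \<delta>" for x
        using sawtooth_bounds[OF t d, of b x] ab(1) by (simp add: \<phi>_def field_simps)
    qed
    moreover have "ess_sup_grad f ?X \<phi> unit_cube \<le> ereal (max (f \<xi>) (f \<eta>))"
      unfolding \<phi>_def
      by (intro ess_sup_grad_le unit_cube_lebesgue sawtooth_grad_bounded t d ab b0)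
    ultimately have "ereal (f ?X) \<le> ereal (max (f \<xi>) (f \<eta>)) + ereal \<epsilon>"
      by (meson add_right_mono order_trans)
    then show "f ?X \<le> max (f \<xi>) (f \<eta>) + \<epsilon>" by (simp del: ereal_max)
  qed
qed


section \<open>Upper semicontinuity and teeth refining towards the boundary\<close>

lemma weak_MQC_usc_imp_rank_one_convex:
  fixes f :: "real^'n^'N \<Rightarrow> real"
  assumes weak: "weak_MQC f" and usc: "upper_semicont f"
  shows "rank_one_convex f"
  unfolding rank_one_convex_def
proof (intro allI impI)
  fix \<xi> \<eta> :: "real^'n^'N" and t :: real
  assume h: "rank (\<xi> - \<eta>) = 1 \<and> 0 < t \<and> t < 1"
  then have t: "0 < t" "t < 1" by auto
  obtain a :: "real^'N" and b :: "real^'n" where ab: "a \<noteq> 0" "norm b = 1" "\<And>h. (\<xi> - \<eta>) *v h = (b \<bullet> h) *\<^sub>R a"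
    using rank_one_decomposition h by blast
  then have b0: "b \<noteq> 0" by auto
  let ?X = "t *\<^sub>R \<xi> + (1 - t) *\<^sub>R \<eta>"
  show "f ?X \<le> max (f \<xi>) (f \<eta>)"
  proof (rule dense_ge)
    fix z assume z: "max (f \<xi>) (f \<eta>) < z"
    have "open {X. f X < z}" using usc by (simp add: upper_semicont_def)
    moreover have "\<xi> \<in> {X. f X < z}" "\<eta> \<in> {X. f X < z}" using z by auto
    ultimately obtain r1 r2 where r: "0 < r1" "cball \<xi> r1 \<subseteq> {X. f X < z}" "0 < r2" "cball \<eta> r2 \<subseteq> {X. f X < z}"
      by (meson open_contains_cball)
    \<comment> \<open>The offsets get a slope \<kappa> so small that the resulting gradient error
      \<open>C * \<kappa>\<close> fits into both balls, where \<open>f\<close> stays below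
      \<open>z\<close>.\<close>
    define C where "C = real CARD('N) * real CARD('n) * norm a"
    have C: "0 < C" using ab(1) by (simp add: C_def)
    define \<kappa> where "\<kappa> = min r1 r2 / C"
    have \<kappa>: "0 < \<kappa>" "C * \<kappa> \<le> r1" "C * \<kappa> \<le> r2" using r C by (auto simp: \<kappa>_def)
    \<comment> \<open>Teeth of scale \<open>q k\<close> cost nothing where the distance to the boundary is at most \<open>q k\<close>, and more
      the farther inside one moves. The envelope therefore refines towards the boundary and vanishes
      on it, while at an interior point only finitely many teeth compete.\<close>
    define e where "e x = infdist x (- unit_cube)" for x :: "real^'n"
    define q where "q k = (1/2::real) ^ k" for k :: nat
    define p where "p = (\<lambda>(k, j::int). \<kappa> / 2 * q k * of_int j)"
    define \<tau> where "\<tau> = (\<lambda>(k, j::int) x. \<kappa> * max 0 (e x - q k))"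
    define u where "u = laminate t b p \<tau>"
    have q: "0 < q k" for k by (simp add: q_def)
    have q_small: "\<exists>k. q k < s" if "0 < s" for s
      unfolding q_def using that by (intro real_arch_pow_inv) auto
    have \<tau>_nonneg: "0 \<le> \<tau> i x" for i x using \<kappa>(1) by (auto simp: \<tau>_def split: prod.split)
    have \<tau>_lip: "\<bar>\<tau> i x - \<tau> i y\<bar> \<le> \<kappa> * norm (x - y)" for i x y
    proof (cases i)
      case (Pair k j)
      have "\<bar>e x - e y\<bar> \<le> norm (x - y)"
        unfolding e_def using infdist_triangle_abs[of x "- unit_cube" y] by (simp add: dist_norm)
      then have "\<bar>max 0 (e x - q k) - max 0 (e y - q k)\<bar> \<le> norm (x - y)" by linarith
      then have "\<kappa> * \<bar>max 0 (e x - q k) - max 0 (e y - q k)\<bar> \<le> \<kappa> * norm (x - y)"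
        using \<kappa>(1) by (intro mult_left_mono) auto
      then show ?thesis using \<kappa>(1) by (simp add: Pair \<tau>_def right_diff_distrib[symmetric] abs_mult)
    qed
    note lam = \<tau>_nonneg \<tau>_lip
    have closed: "closed (- (unit_cube :: (real^'n) set))" unfolding unit_cube_def by (intro closed_Compl open_box)
    have ne: "- (unit_cube :: (real^'n) set) \<noteq> {}"
    proof -
      have "(\<chi> i. 1) \<in> - (unit_cube :: (real^'n) set)" by (simp add: unit_cube_iff)
      then show ?thesis by blast
    qed
    have u_lip: "(\<kappa> + norm b)-lipschitz_on UNIV u"
      unfolding u_def using laminate_lipschitz[OF t _ lam, of b p] \<kappa>(1) by simp
    have u_le: "u x \<le> \<tau> i x + tooth t (b \<bullet> x - p i)" for x i
      unfolding u_def by (rule laminate_le[OF t _ lam]) (use \<kappa>(1) in simp)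
    have u_zero: "u x = 0" if "x \<notin> unit_cube" for x
    proof (rule antisym)
      show "0 \<le> u x" unfolding u_def by (rule laminate_nonneg[OF t _ lam]) (use \<kappa>(1) in simp)
      show "u x \<le> 0"
      \<comment> \<open>Outside the cube \<open>e x = 0\<close>, so all offsets vanish and teeth of
        arbitrarily small scale are available.\<close>
      proof (rule field_le_epsilon)
        fix s :: real assume "0 < s"
        then obtain k where "q k < s / (\<kappa> / 2)" using q_small[of "s / (\<kappa> / 2)"] \<kappa>(1) by auto
        then have k: "\<kappa> / 2 * q k < s" using \<kappa>(1) by (simp add: field_simps)
        obtain j :: int where j: "tooth t (b \<bullet> x - \<kappa> / 2 * q k * of_int j) \<le> \<kappa> / 2 * q k"
          using tooth_near_int_multiple[OF t, of "\<kappa> / 2 * q k"] \<kappa>(1) q[of k] by auto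
        have "e x = 0" unfolding e_def using that by simp
        then have "\<tau> (k, j) x = 0" using q[of k] by (simp add: \<tau>_def)
        then have "u x \<le> tooth t (b \<bullet> x - p (k, j))"
          using u_le[of x "(k, j)"] by simp
        then show "u x \<le> 0 + s" using j k by (simp add: p_def)
      qed
    qed
    have opt: "\<exists>i. \<forall>j. \<tau> i x + tooth t (b \<bullet> x - p i) \<le> \<tau> j x + tooth t (b \<bullet> x - p j)"
      if x: "x \<in> unit_cube" for x
    proof -
      have "0 < e x" unfolding e_def using infdist_pos_not_in_closed[OF closed ne] x by simp
      then obtain k where k: "q k < e x" using q_small by blast
      obtain j :: int where j: "tooth t (b \<bullet> x - \<kappa> / 2 * q k * of_int j) \<le> \<kappa> / 2 * q k"
        using tooth_near_int_multiple[OF t, of "\<kappa> / 2 * q k"] \<kappa>(1) q[of k] by auto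
      define v where "v i = \<tau> i x + tooth t (b \<bullet> x - p i)" for i
      let ?v0 = "v (k, j)"
      \<comment> \<open>The factor 1/2 in the spacing matters here: the tooth costs at most half of
        the saving \<open>\<kappa> * q k\<close>, so the value is strictly below
        \<open>\<kappa> * e x\<close>, the limit of the offsets as the scale tends to 0.\<close>
      have "?v0 \<le> \<kappa> * (e x - q k) + \<kappa> / 2 * q k" using j k by (simp add: v_def \<tau>_def p_def)
      also have "\<dots> < \<kappa> * e x" using mult_pos_pos[OF \<kappa>(1) q[of k]] by (simp add: algebra_simps)
      finally have "0 < e x - ?v0 / \<kappa>" using \<kappa>(1) by (simp add: field_simps)
      then obtain m where m: "q m < e x - ?v0 / \<kappa>" using q_small by blast
      \<comment> \<open>A tooth of scale \<open>q l\<close> has offset at least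
        \<open>\<kappa> * (e x - q l)\<close>, which exceeds \<open>?v0\<close> unless
        \<open>q l > q m\<close>. Only the scales with \<open>l < m\<close> remain, each with
        finitely many teeth.\<close>
      have "{i. v i \<le> ?v0} \<subseteq> (SIGMA l:{..<m}. {j::int. tooth t (b \<bullet> x - \<kappa> / 2 * q l * of_int j) \<le> ?v0})"
      proof (clarsimp, intro conjI)
        fix l and j' :: int assume le: "v (l, j') \<le> v (k, j)"
        then have "\<tau> (l, j') x + tooth t (b \<bullet> x - p (l, j')) \<le> ?v0" by (simp add: v_def)
        then have 1: "tooth t (b \<bullet> x - p (l, j')) \<le> ?v0" "\<tau> (l, j') x \<le> ?v0"
          using \<tau>_nonneg[of "(l, j')" x] tooth_nonneg[OF t, of "b \<bullet> x - p (l, j')"] by linarith+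
        show "tooth t (b \<bullet> x - \<kappa> * q l * real_of_int j' / 2) \<le> v (k, j)" using 1(1) by (simp add: p_def)
        have "\<kappa> * (e x - q l) \<le> ?v0"
          using 1(2) \<kappa>(1) by (simp add: \<tau>_def max_mult_distrib_left)
        then have "e x - ?v0 / \<kappa> \<le> q l" using \<kappa>(1) by (simp add: field_simps)
        then have "q m < q l" using m by linarith
        then show "l < m" by (simp add: q_def power_strict_decreasing_iff)
      qed
      moreover have "finite (SIGMA l:{..<m}. {j::int. tooth t (b \<bullet> x - \<kappa> / 2 * q l * of_int j) \<le> ?v0})"
        using \<kappa>(1) q by (intro finite_SigmaI finite_tooth_sublevel[OF t]) auto
      ultimately show ?thesis
        using minimum_attained[of v "(k, j)"] finite_subset unfolding v_def by blast
    qed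
    have "(\<lambda>x. u x *\<^sub>R a) \<in> W1inf0_Q"
      unfolding W1inf0_Q_def using lipschitz_scaleR_vector[OF u_lip] u_zero by auto
    then have "ereal (f ?X) \<le> ess_sup_grad f ?X (\<lambda>x. u x *\<^sub>R a) unit_cube"
      using weak unfolding weak_MQC_def by blast
    also have "\<dots> \<le> ereal z"
      unfolding u_def
    proof (intro ess_sup_grad_le unit_cube_lebesgue laminate_grad_bounded[OF t _ lam ab(1) b0 ab(3) opt])
      show "0 \<le> \<kappa>" using \<kappa>(1) by simp
      have C\<kappa>: "real CARD('N) * real CARD('n) * (\<kappa> * norm a) = C * \<kappa>" by (simp add: C_def)
      show "f Y \<le> z" if "norm (Y - \<xi>) \<le> real CARD('N) * real CARD('n) * (\<kappa> * norm a)" for Y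
      proof -
        have "Y \<in> cball \<xi> r1"
          using that \<kappa>(2) unfolding C\<kappa> by (simp add: dist_norm norm_minus_commute)
        then show ?thesis using r(2) by auto
      qed
      show "f Y \<le> z" if "norm (Y - \<eta>) \<le> real CARD('N) * real CARD('n) * (\<kappa> * norm a)" for Y
      proof -
        have "Y \<in> cball \<eta> r2"
          using that \<kappa>(3) unfolding C\<kappa> by (simp add: dist_norm norm_minus_commute)
        then show ?thesis using r(4) by auto
      qed
    qed
    finally show "f ?X \<le> z" by simp
  qed
qed

section \<open>The integer lattice and its cells\<close>

definition lattice_point :: "('n \<Rightarrow> int) \<Rightarrow> real^'n" where
  "lattice_point m = (\<chi> i. of_int (m i))"

text \<open>Ties are rounded upwards, so the cells are half-open cubes and partition the
  space.\<close>

definition lattice_round :: "real^'n \<Rightarrow> 'n \<Rightarrow> int" where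
  "lattice_round x i = \<lfloor>x $ i + 1/2\<rfloor>"

lemma lattice_round_unique:
  assumes "x - lattice_point m \<in> unit_cube"
  shows "lattice_round x = m"
proof
  fix i
  have "- 1/2 < x $ i - of_int (m i)" "x $ i - of_int (m i) < 1/2"
    using assms by (auto simp: unit_cube_iff lattice_point_def)
  then show "lattice_round x i = m i" unfolding lattice_round_def by (intro floor_unique) auto
qed

lemma lattice_round_add: "lattice_round (x + lattice_point m) = (\<lambda>i. lattice_round x i + m i)"
proof
  fix i
  have "(x + lattice_point m) $ i + 1/2 = (x $ i + 1/2) + of_int (m i)"
    by (simp add: lattice_point_def)
  then show "lattice_round (x + lattice_point m) i = lattice_round x i + m i"
    unfolding lattice_round_def by (simp only: floor_add_int)
qed

lemma in_hyperplane_or_lattice_cube: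
  "x \<in> (\<Union>(i, k::int). {x::real^'n. axis i 1 \<bullet> x = of_int k + 1/2}) \<or>
   x - lattice_point (lattice_round x) \<in> unit_cube"
proof (rule disjCI)
  assume not_cube: "x - lattice_point (lattice_round x) \<notin> unit_cube"
  then obtain i where "\<not> (- 1/2 < x $ i - of_int \<lfloor>x $ i + 1/2\<rfloor> \<and> x $ i - of_int \<lfloor>x $ i + 1/2\<rfloor> < 1/2)"
    by (auto simp: unit_cube_iff lattice_point_def lattice_round_def)
  \<comment> \<open>The remainder always lies in [-1/2, 1/2), so it must be -1/2; writing this with
    + 1/2 lowers the integer by one.\<close>
  then have "x $ i = of_int (\<lfloor>x $ i + 1/2\<rfloor> - 1) + 1/2" by simp linarith
  then have "axis i 1 \<bullet> x = of_int (\<lfloor>x $ i + 1/2\<rfloor> - 1) + 1/2" by (simp add: inner_axis')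
  then show "x \<in> (\<Union>(i, k::int). {x::real^'n. axis i 1 \<bullet> x = of_int k + 1/2})" by blast
qed

text \<open>Off countably many hyperplanes each point has a lattice translate in the open cube, so
  countably many translates of the part in that cube cover the rest.\<close>

lemma negligible_of_lattice_periodic:
  fixes P :: "real^'n \<Rightarrow> bool"
  assumes per: "\<And>x m. P (x + lattice_point m) \<Longrightarrow> P x" and neg: "negligible {x \<in> unit_cube. P x}"
  shows "negligible {x. P x}"
proof (rule negligible_subset)
  let ?H = "\<Union>(i, k::int). {x::real^'n. axis i 1 \<bullet> x = of_int k + 1/2}"
  let ?T = "\<Union>m::'n \<Rightarrow> int. (+) (lattice_point m) ` {x \<in> unit_cube. P x}"
  have "axis i 1 \<noteq> (0::real^'n)" for i by (simp add: axis_eq_0_iff)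
  then have "negligible ?H"
    by (intro negligible_countable_Union) (auto simp: negligible_hyperplane)
  moreover have "negligible ?T"
    by (intro negligible_countable_Union) (auto intro: negligible_translation neg)
  ultimately show "negligible (?H \<union> ?T)" by (rule negligible_Un)
  show "{x. P x} \<subseteq> ?H \<union> ?T"
  proof clarify
    fix x assume "P x" "x \<notin> ?T"
    have "x - lattice_point (lattice_round x) \<notin> unit_cube"
    proof
      assume "x - lattice_point (lattice_round x) \<in> unit_cube"
      moreover have "P (x - lattice_point (lattice_round x))"
        using per[of "x - lattice_point (lattice_round x)" "lattice_round x"] \<open>P x\<close> by simp
      ultimately have "x \<in> ?T" by (force intro!: image_eqI[of _ _ "x - lattice_point (lattice_round x)"])
      with \<open>x \<notin> ?T\<close> show False by blast
    qed
    then show "x \<in> ?H" using in_hyperplane_or_lattice_cube by blast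
  qed
qed

text \<open>Integer multiples of one axis vector come first, by induction in both directions; the
  coordinates are then added one at a time.\<close>

lemma axis_periodic_imp_lattice_periodic:
  fixes \<phi> :: "real^'n \<Rightarrow> 'b"
  assumes per: "\<And>x i. \<phi> (x + axis i 1) = \<phi> x"
  shows "\<phi> (x + lattice_point m) = \<phi> x"
proof -
  have mult: "\<phi> (x + of_int k *\<^sub>R axis i 1) = \<phi> x" for x i and k :: int
  proof (induction k arbitrary: x rule: int_induct[where k = 0])
    case (step1 k)
    have "\<phi> (x + of_int (k + 1) *\<^sub>R axis i 1) = \<phi> ((x + of_int k *\<^sub>R axis i 1) + axis i 1)"
      by (simp add: algebra_simps)
    then show ?case by (simp only: per step1)
  next
    case (step2 k)
    have "\<phi> (x + of_int (k - 1) *\<^sub>R axis i 1) = \<phi> ((x + of_int (k - 1) *\<^sub>R axis i 1) + axis i 1)"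
      by (simp only: per)
    also have "\<dots> = \<phi> (x + of_int k *\<^sub>R axis i 1)" by (simp add: algebra_simps)
    finally show ?case by (simp only: step2)
  qed simp
  have "\<phi> (x + (\<Sum>i\<in>F. of_int (m i) *\<^sub>R axis i 1)) = \<phi> x" if "finite F" for F
    using that
  proof (induction F)
    case (insert i F)
    have "\<phi> (x + (\<Sum>i\<in>insert i F. of_int (m i) *\<^sub>R axis i 1))
        = \<phi> ((x + (\<Sum>i\<in>F. of_int (m i) *\<^sub>R axis i 1)) + of_int (m i) *\<^sub>R axis i 1)"
      using insert by (simp add: algebra_simps)
    then show ?case by (simp only: mult insert.IH)
  qed simp
  from this[OF finite] have "\<phi> (x + (\<Sum>i\<in>UNIV. of_int (m i) *\<^sub>R axis i 1)) = \<phi> x" .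
  moreover have "(\<Sum>i\<in>UNIV. of_int (m i) *\<^sub>R axis i 1) = lattice_point m"
    using basis_expansion[of "lattice_point m"]
    by (simp add: lattice_point_def scalar_mult_eq_scaleR)
  ultimately show ?thesis by (simp only:)
qed

lemma cube_0_1: "cube 0 1 (mat 1) = unit_cube"
  by (simp add: cube_def unit_cube_def)

lemma W1inf_per_0_1_iff:
  fixes \<phi> :: "real^'n \<Rightarrow> real^'N"
  shows "\<phi> \<in> W1inf_per 0 1 (mat 1) \<longleftrightarrow> (\<exists>L. L-lipschitz_on UNIV \<phi>) \<and> bounded (range \<phi>) \<and>
     (\<forall>x m. \<phi> (x + lattice_point m) = \<phi> x)"
proof -
  have col: "column i (mat 1) = (axis i 1 :: real^'n)" for i
    by (simp add: vec_eq_iff column_def mat_def axis_def)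
  have lat: "axis i 1 = lattice_point (\<lambda>j. if j = i then 1 else 0)" for i :: 'n
    by (simp add: vec_eq_iff lattice_point_def axis_def)
  have "(\<forall>x i. \<phi> (x + axis i 1) = \<phi> x) \<longleftrightarrow> (\<forall>x m. \<phi> (x + lattice_point m) = \<phi> x)"
    by (safe; (rule axis_periodic_imp_lattice_periodic | simp only: lat); blast)
  then show ?thesis by (simp add: W1inf_per_def col)
qed

lemma grad_bounded_shift:
  assumes per: "\<And>y. \<phi> (y + v) = \<phi> y" and gb: "grad_bounded f \<xi> \<phi> z x"
  shows "grad_bounded f \<xi> \<phi> z (x + v)"
  unfolding grad_bounded_def
proof (intro allI impI)
  fix D assume "(\<phi> has_derivative D) (at (x + v))"
  then have "((\<lambda>y. \<phi> (y + v)) has_derivative (\<lambda>h. D h)) (at x)"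
    by (intro has_derivative_compose[of "\<lambda>y. y + v" "\<lambda>h. h" x UNIV \<phi> D]) (auto intro!: derivative_eq_intros)
  then show "ereal (f (\<xi> + matrix D)) \<le> z"
    using gb by (simp add: per grad_bounded_def)
qed

text \<open>By the chain rule the rescaled map has at \<open>x\<close> the derivative of \<phi> at
  \<open>k *\<^sub>R x\<close>. The proof undoes the scaling, because the derivative given is that
  of the rescaled map.\<close>

lemma grad_bounded_rescale:
  fixes \<phi> :: "real^'n \<Rightarrow> real^'N"
  assumes "k \<noteq> 0" and gb: "grad_bounded f \<xi> \<phi> z (k *\<^sub>R x)"
  shows "grad_bounded f \<xi> (\<lambda>y. (1 / k) *\<^sub>R \<phi> (k *\<^sub>R y)) z x"
  unfolding grad_bounded_def
proof (intro allI impI)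
  fix D assume D: "((\<lambda>y. (1 / k) *\<^sub>R \<phi> (k *\<^sub>R y)) has_derivative D) (at x)"
  have "((\<lambda>y. (1 / k) *\<^sub>R \<phi> (k *\<^sub>R ((1 / k) *\<^sub>R y))) has_derivative (\<lambda>h. D ((1 / k) *\<^sub>R h))) (at (k *\<^sub>R x))"
    using D assms(1)
    by (intro has_derivative_compose[of "\<lambda>y. (1 / k) *\<^sub>R y" "\<lambda>h. (1 / k) *\<^sub>R h" "k *\<^sub>R x" UNIV
          "\<lambda>y. (1 / k) *\<^sub>R \<phi> (k *\<^sub>R y)" D]) (auto intro!: derivative_eq_intros)
  then have "((\<lambda>y. k *\<^sub>R (1 / k) *\<^sub>R \<phi> (k *\<^sub>R ((1 / k) *\<^sub>R y))) has_derivative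
      (\<lambda>h. k *\<^sub>R D ((1 / k) *\<^sub>R h))) (at (k *\<^sub>R x))"
    by (rule has_derivative_scaleR_right)
  then have "(\<phi> has_derivative D) (at (k *\<^sub>R x))"
    using assms(1) by (simp add: linear_scale[OF has_derivative_linear[OF D]])
  then show "ereal (f (\<xi> + matrix D)) \<le> z" using gb by (simp add: grad_bounded_def)
qed

section \<open>From strong to periodic to weak quasiconvexity\<close>

lemma strong_MQC_imp_periodic_weak_MQC:
  fixes f :: "real^'n^'N \<Rightarrow> real"
  assumes strong: "strong_MQC f"
  shows "periodic_weak_MQC f"
  unfolding periodic_weak_MQC_def periodic_weak_MQC_in_def cube_0_1
proof (intro allI impI le_ess_sup_grad[OF unit_cube_lebesgue])
  fix \<xi> :: "real^'n^'N" and \<phi> :: "real^'n \<Rightarrow> real^'N" and z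
  assume "\<phi> \<in> W1inf_per 0 1 (mat 1)"
  then obtain L B where lip: "L-lipschitz_on UNIV \<phi>" and B: "\<And>x. norm (\<phi> x) \<le> B"
    and per: "\<And>x m. \<phi> (x + lattice_point m) = \<phi> x"
    unfolding W1inf_per_0_1_iff bounded_iff by blast
  assume "negligible {x \<in> unit_cube. \<not> grad_bounded f \<xi> \<phi> z x}"
  \<comment> \<open>Periodicity spreads the bound from one cell to the whole space, so the factor
    \<open>k\<close> below may be any positive real.\<close>
  then have neg: "negligible {x. \<not> grad_bounded f \<xi> \<phi> z x}"
  proof (rule negligible_of_lattice_periodic[rotated])
    show "\<not> grad_bounded f \<xi> \<phi> z x" if "\<not> grad_bounded f \<xi> \<phi> z (x + lattice_point m)" for x m
      using that grad_bounded_shift[of \<phi> "lattice_point m", OF per] by blast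
  qed
  show "ereal (f \<xi>) \<le> z"
  proof (rule ereal_le_epsilon2)
    fix \<epsilon> :: real assume "0 < \<epsilon>"
    then obtain \<delta> where \<delta>: "0 < \<delta>"
      "\<forall>\<phi>. (L)-lipschitz_on UNIV \<phi> \<longrightarrow> (\<forall>x. norm (\<phi> x) \<le> \<delta>) \<longrightarrow>
         ereal (f \<xi>) \<le> ess_sup_grad f \<xi> \<phi> unit_cube + ereal \<epsilon>"
      using strong_MQC_uniform[OF strong, of \<epsilon> L \<xi>] by blast
    \<comment> \<open>This makes \<open>B / k\<close> at most \<delta>, while the rescaling keeps
      the Lipschitz constant \<open>L\<close>.\<close>
    define k where "k = B / \<delta> + 1"
    have "0 \<le> B" using B[of 0] norm_ge_zero order_trans by blast
    then have k: "0 < k" "B \<le> k * \<delta>" using \<delta>(1) by (simp_all add: k_def add_nonneg_pos distrib_right)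
    define \<psi> where "\<psi> = (\<lambda>y. (1 / k) *\<^sub>R \<phi> (k *\<^sub>R y))"
    have "ereal (f \<xi>) \<le> ess_sup_grad f \<xi> \<psi> unit_cube + ereal \<epsilon>"
    proof (intro \<delta>(2)[rule_format])
      show "L-lipschitz_on UNIV \<psi>"
      proof (rule lipschitz_onI)
        show "0 \<le> L" using lip by (rule lipschitz_on_nonneg)
        fix x y
        have "dist (\<phi> (k *\<^sub>R x)) (\<phi> (k *\<^sub>R y)) \<le> L * dist (k *\<^sub>R x) (k *\<^sub>R y)"
          using lipschitz_onD[OF lip] by simp
        then show "dist (\<psi> x) (\<psi> y) \<le> L * dist x y"
          using k(1) by (simp add: \<psi>_def dist_norm scaleR_diff_right[symmetric] divide_le_eq mult.left_commute mult.commute)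
      qed
      show "norm (\<psi> x) \<le> \<delta>" for x
        using order_trans[OF B k(2), of "k *\<^sub>R x"] k(1) by (simp add: \<psi>_def divide_le_eq mult.commute)
    qed
    moreover have "ess_sup_grad f \<xi> \<psi> unit_cube \<le> z"
    proof (rule ess_sup_grad_le[OF unit_cube_lebesgue negligible_subset])
      show "negligible ((\<lambda>x. (1 / k) *\<^sub>R x) ` {x. \<not> grad_bounded f \<xi> \<phi> z x})"
        using neg
        by (intro negligible_differentiable_image_negligible linear_imp_differentiable_on linear_scale_self) simp_all
      show "{x \<in> unit_cube. \<not> grad_bounded f \<xi> \<psi> z x} \<subseteq> (\<lambda>x. (1 / k) *\<^sub>R x) ` {x. \<not> grad_bounded f \<xi> \<phi> z x}"
      proof clarify
        fix x assume "\<not> grad_bounded f \<xi> \<psi> z x"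
        then have "\<not> grad_bounded f \<xi> \<phi> z (k *\<^sub>R x)"
          using grad_bounded_rescale[of k] k(1) unfolding \<psi>_def by blast
        then show "x \<in> (\<lambda>x. (1 / k) *\<^sub>R x) ` {x. \<not> grad_bounded f \<xi> \<phi> z x}"
          using k(1) by (intro image_eqI[of _ _ "k *\<^sub>R x"]) auto
      qed
    qed
    ultimately show "ereal (f \<xi>) \<le> z + ereal \<epsilon>" by (meson add_right_mono order_trans)
  qed
qed

lemma periodic_weak_MQC_imp_weak_MQC:
  fixes f :: "real^'n^'N \<Rightarrow> real"
  assumes per: "periodic_weak_MQC f"
  shows "weak_MQC f"
  unfolding weak_MQC_def
proof (intro allI impI le_ess_sup_grad[OF unit_cube_lebesgue])
  fix \<xi> :: "real^'n^'N" and \<phi> :: "real^'n \<Rightarrow> real^'N" and z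
  assume "\<phi> \<in> W1inf0_Q"
  then obtain L where lip: "L-lipschitz_on UNIV \<phi>" and zero: "\<And>x. x \<notin> unit_cube \<Longrightarrow> \<phi> x = 0"
    unfolding W1inf0_Q_def by blast
  assume neg: "negligible {x \<in> unit_cube. \<not> grad_bounded f \<xi> \<phi> z x}"
  \<comment> \<open>The periodic extension of \<phi> from the open cube; on the boundaries of the
    cells it is 0.\<close>
  define \<psi> where "\<psi> x = \<phi> (x - lattice_point (lattice_round x))" for x
  have L: "0 \<le> L" using lip by (rule lipschitz_on_nonneg)
  have \<psi>_eq: "\<psi> x = \<phi> x" if "x \<in> unit_cube" for x
  proof -
    have "lattice_point (\<lambda>_. 0) = (0 :: real^'n)" by (simp add: lattice_point_def vec_eq_iff)
    then show ?thesis using lattice_round_unique[of x "\<lambda>_. 0"] that by (simp add: \<psi>_def)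
  qed
  have "\<psi> \<in> W1inf_per 0 1 (mat 1)"
    unfolding W1inf_per_0_1_iff
  proof (intro conjI allI exI)
    \<comment> \<open>Translate \<open>y\<close> by the lattice vector of \<open>x\<close>: it leaves the cube, where \<open>\<phi>\<close> vanishes.\<close>
    have other_cell: "norm (\<psi> x) \<le> L * dist x y" if "lattice_round x \<noteq> lattice_round y" for x y
    proof -
      have "\<phi> (y - lattice_point (lattice_round x)) = 0"
        using zero lattice_round_unique that by metis
      then show ?thesis
        using lipschitz_onD[OF lip, of "x - lattice_point (lattice_round x)" "y - lattice_point (lattice_round x)"]
        by (simp add: \<psi>_def dist_norm)
    qed
    \<comment> \<open>The factor 2 comes from points in different cells, where
      \<open>other_cell\<close> bounds each value separately.\<close>
    show "(2 * L)-lipschitz_on UNIV \<psi>"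
    proof (rule lipschitz_onI)
      show "0 \<le> 2 * L" using L by simp
      fix x y
      show "dist (\<psi> x) (\<psi> y) \<le> 2 * L * dist x y"
      proof (cases "lattice_round x = lattice_round y")
        case True
        then have "dist (\<psi> x) (\<psi> y) \<le> L * dist x y"
          using lipschitz_onD[OF lip, of "x - lattice_point (lattice_round x)" "y - lattice_point (lattice_round x)"]
          by (simp add: \<psi>_def dist_norm)
        also have "\<dots> \<le> 2 * L * dist x y" using L by (simp add: mult_right_mono)
        finally show ?thesis .
      next
        case False
        then have "norm (\<psi> x) \<le> L * dist x y" "norm (\<psi> y) \<le> L * dist x y"
          using other_cell[of x y] other_cell[of y x] by (auto simp: dist_commute)
        then show ?thesis using norm_triangle_ineq4[of "\<psi> x" "\<psi> y"] by (simp add: dist_norm)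
      qed
    qed
    have "compact (\<phi> ` closure unit_cube)"
      by (intro compact_continuous_image continuous_on_subset[OF lipschitz_on_continuous_on[OF lip]])
         (auto simp: unit_cube_def)
    then have "bounded (insert 0 (\<phi> ` closure unit_cube))" by (simp add: compact_imp_bounded)
    moreover have "range \<psi> \<subseteq> insert 0 (\<phi> ` closure unit_cube)"
      using zero closure_subset[of unit_cube] unfolding \<psi>_def by blast
    ultimately show "bounded (range \<psi>)" by (rule bounded_subset)
    show "\<psi> (x + lattice_point m) = \<psi> x" for x m
      by (simp add: \<psi>_def lattice_round_add) (simp add: lattice_point_def vec_eq_iff plus_vec_def minus_vec_def)
  qed
  then have "ereal (f \<xi>) \<le> ess_sup_grad f \<xi> \<psi> unit_cube"
    using per unfolding periodic_weak_MQC_def periodic_weak_MQC_in_def cube_0_1 by blast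
  also have "\<dots> \<le> z"
  proof (intro ess_sup_grad_le[OF unit_cube_lebesgue] negligible_subset[OF neg] Collect_mono impI conjI; elim conjE)
    fix x :: "real^'n" assume x: "x \<in> unit_cube" "\<not> grad_bounded f \<xi> \<psi> z x"
    \<comment> \<open>The cube is open, so both maps agree near \<open>x\<close>.\<close>
    have "(\<phi> has_derivative D) (at x)" if "(\<psi> has_derivative D) (at x)" for D
      using that x(1) \<psi>_eq
      by (intro has_derivative_transform_within_open[of \<psi> D x UNIV unit_cube \<phi>]) (auto simp: unit_cube_def)
    then show "\<not> grad_bounded f \<xi> \<phi> z x" using x(2) unfolding grad_bounded_def by blast
  qed
  finally show "ereal (f \<xi>) \<le> z" .
qed

theorem mainTheorem7:
  fixes f :: "real^'n^'N \<Rightarrow> real"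
  assumes "f \<in> borel_measurable borel"
  shows "(strong_MQC f \<longrightarrow> weak_MQC f \<and> periodic_weak_MQC f)
    \<and> (periodic_weak_MQC f \<longrightarrow> weak_MQC f)
    \<and> (weak_MQC f \<and> upper_semicont f \<longrightarrow> rank_one_convex f)
    \<and> ((\<forall>c r R. 0 < r \<and> orthogonal_matrix R \<longrightarrow> periodic_weak_MQC_in c r R f)
          \<longrightarrow> rank_one_convex f)
    \<and> (strong_MQC f \<longrightarrow> rank_one_convex f)"
  using strong_MQC_imp_periodic_weak_MQC periodic_weak_MQC_imp_weak_MQC
    weak_MQC_usc_imp_rank_one_convex periodic_weak_MQC_in_imp_rank_one_convex
    strong_MQC_imp_rank_one_convex
  by blast


end
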